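(* Let $\theta>0$ and let $s:[0,\infty)\to[0,\infty)$ be continuous and strictly increasing with $s(0)=0$ and $s(1)=1$, satisfying $$s(x+1)\le s(x)+1\quad\text{for all }x\ge0\qquad\text{and}\qquad|s(x+1)-s(y+1)|\le|s(x)-s(y)|\quad\text{for all }x,y\ge0.$$ Then there exists a unique distribution $\mathcal{D}_{\theta,s}$ for a non-negative random variable $D_{\theta,s}$ such that $s(D_{\theta,s})$ has finite mean and $$D_{\theta,s}=_d s^{-1}\big(U^{1/\theta}s(D_{\theta,s}+1)\big),$$ where $U\sim\mathcal{U}[0,1]$ is independent of $D_{\theta,s}$. In addition, $D_{\theta,s}\le_{\rm st}s^{-}(D_\theta)$, where $D_\theta\sim\mathcal{D}_\theta$.
   Context: $=_d$ denotes equality in distribution. The generalized Dickman distribution $\mathcal{D}_\theta$ is the unique law of a non-negative random variable $W$ satisfying $W=_dU^{1/\theta}(W+1)$, with $U\sim\mathcal{U}[0,1]$ independent of $W$. The generalized inverse of $s$ is $s^{-}(x)=\inf\{y: s(y)\ge x\}$, with $\inf\emptyset=\infty$, so that $s^-(D_\theta)$ takes values in the extended real line; $s^-$ and $s^{-1}$ agree on the range of $s$. For extended-real-valued random variables, $V\le_{\rm st}W$ means $P(V\ge t)\le P(W\ge t)$ for all $t$ in the extended real line. *)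

theory Defs
  imports "HOL-Probability.Probability"
begin

definition halfline :: "real measure" where
  "halfline = restrict_space borel {0..}"

text \<open>
  The law of a non-negative random variable is a probability measure whose underlying measurable
  space is the half-line itself. Thus the values outside \<open>{0..}\<close> of a total function such as
  \<open>s :: real \<Rightarrow> real\<close> play no role.
\<close>

definition nonneg_law :: "real measure \<Rightarrow> bool" where
  "nonneg_law \<mu> \<longleftrightarrow> prob_space \<mu> \<and> sets \<mu> = sets halfline"

definition unif01 :: "real measure" where
  "unif01 = restrict_space lborel {0..1}"

text \<open>
  The joint law of a uniform \<open>U\<close> and an independent \<open>W\<close> of law \<open>\<mu>\<close> is \<open>unif01 \<Otimes>\<^sub>M \<mu>\<close>, so the law
  of \<open>f(U, W)\<close> is the image of this product under \<open>f\<close>.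
\<close>

definition is_gen_dickman :: "real \<Rightarrow> real measure \<Rightarrow> bool" where
  "is_gen_dickman \<theta> \<mu> \<longleftrightarrow> nonneg_law \<mu> \<and>
     \<mu> = distr (unif01 \<Otimes>\<^sub>M \<mu>) halfline (\<lambda>(u, w). u powr (1 / \<theta>) * (w + 1))"

definition gen_dickman :: "real \<Rightarrow> real measure" where
  "gen_dickman \<theta> = (THE \<mu>. is_gen_dickman \<theta> \<mu>)"

text \<open>
  For continuous \<open>s\<close> with \<open>s 0 = 0\<close>, the number \<open>u powr (1 / \<theta>) * s (d + 1)\<close> lies between
  \<open>s 0\<close> and \<open>s (d + 1)\<close>, hence in the range of \<open>s\<close> on \<open>{0..}\<close>, where \<open>inv_into {0..} s\<close> is the
  genuine inverse (also when \<open>s\<close> is bounded).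
\<close>

definition is_dickman_utility_law :: "real \<Rightarrow> (real \<Rightarrow> real) \<Rightarrow> real measure \<Rightarrow> bool" where
  "is_dickman_utility_law \<theta> s \<mu> \<longleftrightarrow> nonneg_law \<mu> \<and> integrable \<mu> s \<and>
     \<mu> = distr (unif01 \<Otimes>\<^sub>M \<mu>) halfline
           (\<lambda>(u, d). inv_into {0..} s (u powr (1 / \<theta>) * s (d + 1)))"

definition gen_inverse :: "(real \<Rightarrow> real) \<Rightarrow> real \<Rightarrow> ereal" where
  "gen_inverse s x = Inf (ereal ` {y. 0 \<le> y \<and> x \<le> s y})"

definition st_le :: "'a measure \<Rightarrow> ('a \<Rightarrow> ereal) \<Rightarrow> 'b measure \<Rightarrow> ('b \<Rightarrow> ereal) \<Rightarrow> bool" where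
  "st_le M V N W \<longleftrightarrow> V \<in> borel_measurable M \<and> W \<in> borel_measurable N \<and>
     (\<forall>t. measure M {\<omega> \<in> space M. t \<le> V \<omega>} \<le> measure N {\<omega> \<in> space N. t \<le> W \<omega>})"

end

theory Submission
  imports Defs
begin

text \<open>
  On the scale \<open>X = s D\<close> the equation reads \<open>X =\<^sub>d U powr (1 / \<theta>) * g X\<close>, where \<open>g (s x) = s (x + 1)\<close>.
  The hypotheses say that \<open>g\<close> is nondecreasing, \<open>1\<close>-Lipschitz and satisfies \<open>g t \<le> t + 1\<close>. It is
  extended to the whole line by an infimum formula (\<open>shift\<close>) that keeps these properties, whether
  or not \<open>s\<close> is bounded.

  Instead of coupling random variables, the proof works with the transition operator
  \<open>T f t = E (f (U powr (1 / \<theta>) * g t))\<close> on bounded monotone Lipschitz functions \<open>f\<close>. It multiplies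
  the Lipschitz constant by \<open>c = \<theta> / (\<theta> + 1) < 1\<close>, the mean of the uniform factor, so the iterates
  become flat and every law \<open>\<nu>\<close> fixed by the step satisfies \<open>\<integral> f d\<nu> = lim T^n f 0\<close>
  (\<open>fixed_law_integral_tendsto\<close>). This gives uniqueness without any moment condition. If \<open>g \<le> h\<close>,
  the iterates are ordered as well, and the fixed laws are stochastically ordered
  (\<open>fixed_law_mono\<close>). As the generalized Dickman distribution is the case \<open>s x = x\<close>, whose map
  \<open>t + 1\<close> is the largest one admitted, this is the stochastic domination.

  For existence, the chain started at \<open>0\<close> has means at most \<open>\<theta>\<close>, hence is tight, and
  a weak limit point is fixed because the iterates forget one additional initial step
  (\<open>fixed_law_exists\<close>). The bound on the means survives in the limit
  (\<open>fixed_law_finite_mean\<close>). To return to \<open>D\<close> the fixed law must live on the range of \<open>s\<close>; when \<open>s\<close>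
  is bounded this is a separate argument by stationarity (\<open>fixed_law_in_range\<close>).
\<close>

section \<open>The uniform factor\<close>

lemma prob_space_unif01: "prob_space unif01"
  unfolding unif01_def
  by (rule prob_space_restrict_space) auto

lemma space_unif01 [simp]: "space unif01 = {0..1}"
  by (simp add: unif01_def space_restrict_space)

lemma measurable_unif01 [measurable (raw)]:
  "f \<in> borel_measurable borel \<Longrightarrow> f \<in> borel_measurable unif01"
  unfolding unif01_def by (intro measurable_restrict_space1) simp

lemma powr_in_unit_interval:
  fixes u \<theta> :: real
  assumes "\<theta> > 0" "u \<in> {0..1}"
  shows "0 \<le> u powr (1 / \<theta>)" "u powr (1 / \<theta>) \<le> 1"
  using assms by (auto intro: powr_le1)

lemma integral_unif01_powr:
  assumes "\<theta> > 0"
  shows "(\<integral>u. u powr (1 / \<theta>) \<partial>unif01) = \<theta> / (\<theta> + 1)"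
proof -
  have int: "set_integrable lborel {0..1::real} (\<lambda>u. u powr (1 / \<theta>))"
    using assms by (intro borel_integrable_atLeastAtMost' continuous_on_powr') auto
  have "((\<lambda>u. u powr (1 / \<theta>)) has_integral (1 powr (1 / \<theta> + 1) / (1 / \<theta> + 1))) {0..1::real}"
    using assms by (intro has_integral_powr_from_0) (auto intro: less_trans[of _ 0])
  then have "integral {0..1} (\<lambda>u. u powr (1 / \<theta>)) = 1 / (1 / \<theta> + 1)"
    by (simp add: integral_unique)
  then have "(\<integral>u. indicator {0..1} u *\<^sub>R u powr (1 / \<theta>) \<partial>lborel) = 1 / (1 / \<theta> + 1)"
    using set_borel_integral_eq_integral(2)[OF int] by (simp add: set_lebesgue_integral_def)
  then show ?thesis
    using assms by (simp add: unif01_def integral_restrict_space field_simps)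
qed

section \<open>Test functions\<close>

text \<open>
  Monotone Lipschitz functions with values in the unit interval form a class that the transition
  operator below preserves, that is compatible with stochastic order, and that determines a law on
  the line. The Lipschitz constant is recorded because its decay drives all limits.
\<close>

definition test_function :: "real \<Rightarrow> (real \<Rightarrow> real) \<Rightarrow> bool" where
  "test_function L f \<longleftrightarrow> mono f \<and> (\<forall>x. 0 \<le> f x \<and> f x \<le> 1) \<and> (\<forall>x y. \<bar>f x - f y\<bar> \<le> L * \<bar>x - y\<bar>)"

lemma test_function_measurable:
  "test_function L f \<Longrightarrow> f \<in> borel_measurable borel"
  by (simp add: test_function_def borel_measurable_mono)

lemma test_function_integrable:
  assumes "test_function L f" "prob_space M" "h \<in> borel_measurable M"
  shows "integrable M (\<lambda>x. f (h x))"
proof -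
  interpret prob_space M by fact
  show ?thesis
    using assms test_function_measurable[OF assms(1)]
    by (intro integrable_const_bound[of _ 1]) (auto simp: test_function_def intro: measurable_compose)
qed

lemma test_function_isCont:
  assumes "test_function L f"
  shows "isCont f x"
proof -
  have "(max 0 L)-lipschitz_on UNIV f"
  proof (rule lipschitz_onI)
    fix x y
    have "\<bar>f x - f y\<bar> \<le> L * \<bar>x - y\<bar>"
      using assms by (auto simp: test_function_def)
    also have "\<dots> \<le> max 0 L * \<bar>x - y\<bar>"
      by (intro mult_right_mono) auto
    finally show "dist (f x) (f y) \<le> max 0 L * dist x y"
      by (simp add: dist_real_def)
  qed auto
  then show ?thesis
    using lipschitz_on_continuous_on continuous_on_eq_continuous_at open_UNIV by blast
qed

text \<open>
  A ramp of slope \<open>k\<close> that reaches \<open>1\<close> at \<open>a\<close>; as \<open>k\<close> grows, it decreases to the indicator of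
  \<open>{a..}\<close>.
\<close>

definition ramp :: "real \<Rightarrow> real \<Rightarrow> real \<Rightarrow> real" where
  "ramp k a x = min 1 (max 0 (1 + k * (x - a)))"

lemma test_function_ramp:
  assumes "k \<ge> 0"
  shows "test_function k (ramp k a)"
proof -
  have "\<bar>ramp k a x - ramp k a y\<bar> \<le> k * \<bar>x - y\<bar>" for x y
  proof -
    have "\<bar>ramp k a x - ramp k a y\<bar> \<le> \<bar>k * (x - a) - k * (y - a)\<bar>"
      unfolding ramp_def by linarith
    also have "\<dots> = \<bar>k * (x - y)\<bar>"
      by (simp add: algebra_simps)
    finally show ?thesis
      using assms by (simp add: abs_mult)
  qed
  moreover have "mono (ramp k a)"
    unfolding ramp_def using assms
    by (intro monoI min.mono max.mono add_mono mult_left_mono) auto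
  ultimately show ?thesis
    by (auto simp: test_function_def ramp_def)
qed

text \<open>
  The ramp of slope \<open>1 / k\<close> that ends at \<open>k\<close> starts at \<open>0\<close>: it is a truncated and rescaled
  positive part, through which test functions see means and tails.
\<close>

lemma mult_ramp:
  assumes "k > 0"
  shows "k * ramp (1 / k) k t = min k (max 0 t)"
proof -
  have "1 + 1 / k * (t - k) = t / k"
    using assms by (simp add: field_simps)
  then have "k * ramp (1 / k) k t = k * min 1 (max 0 (t / k))"
    by (simp only: ramp_def)
  also have "\<dots> = min k (max 0 t)"
    using assms by (cases "t \<le> 0"; cases "t \<le> k") (auto simp: min_def max_def field_simps)
  finally show ?thesis .
qed

lemma ramp_le_linear:
  assumes "k > 0"
  shows "ramp (1 / k) k t \<le> 1 / k * max 0 t"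
proof -
  have "k * ramp (1 / k) k t \<le> max 0 t"
    using assms by (simp add: mult_ramp)
  then show ?thesis
    using assms by (simp add: field_simps)
qed

lemma ramp_integral_tendsto:
  assumes "real_distribution M"
  shows "(\<lambda>n. \<integral>x. ramp (real n) a x \<partial>M) \<longlonglongrightarrow> measure M {a..}"
proof -
  interpret real_distribution M by fact
  have "(\<lambda>n. ramp (real n) a x) \<longlonglongrightarrow> indicator {a..} x" for x
  proof (cases "a \<le> x")
    case False
    have "\<forall>\<^sub>F n in sequentially. ramp (real n) a x = 0"
    proof -
      obtain N :: nat where N: "1 / (a - x) < real N"
        using reals_Archimedean2 by blast
      have "ramp (real n) a x = 0" if "n \<ge> N" for n
      proof -
        have "1 / (a - x) < real n" using N that by simp
        then show ?thesis
          using False by (auto simp: ramp_def field_simps max_def min_def)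
      qed
      then show ?thesis by (auto simp: eventually_sequentially)
    qed
    then show ?thesis
      using False by (auto intro: tendsto_eventually)
  qed (auto simp: ramp_def)
  then have "(\<lambda>n. \<integral>x. ramp (real n) a x \<partial>M) \<longlonglongrightarrow> (\<integral>x. indicator {a..} x \<partial>M)"
    by (intro integral_dominated_convergence[where w = "\<lambda>_. 1"])
       (auto simp: ramp_def abs_le_iff)
  then show ?thesis by simp
qed

lemma measure_atLeast_le:
  assumes "real_distribution M" "real_distribution N"
    and le: "\<And>L f. test_function L f \<Longrightarrow> (\<integral>x. f x \<partial>M) \<le> (\<integral>x. f x \<partial>N)"
  shows "measure M {a..} \<le> measure N {a..}"
proof (rule LIMSEQ_le[OF ramp_integral_tendsto ramp_integral_tendsto])
  show "\<exists>n0. \<forall>n\<ge>n0. (\<integral>x. ramp (real n) a x \<partial>M) \<le> (\<integral>x. ramp (real n) a x \<partial>N)"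
    by (intro exI[of _ 0] allI impI le[OF test_function_ramp]) simp
qed fact+

text \<open>
  The closed upper half-lines are stable under intersection and generate the Borel sets.
\<close>

lemma law_eqI_atLeast:
  assumes M: "real_distribution M" and N: "real_distribution N"
    and eq: "\<And>a. measure M {a..} = measure N {a..}"
  shows "M = N"
proof (rule measure_eqI_generator_eq[where \<Omega> = UNIV and E = "range atLeast"
      and A = "\<lambda>n::nat. {- real n..}"])
  interpret M: real_distribution M by fact
  interpret N: real_distribution N by fact
  have gen: "sets borel = sigma_sets UNIV (range (atLeast :: real \<Rightarrow> _))"
    by (subst borel_Ici) simp
  show "sets M = sigma_sets UNIV (range atLeast)" "sets N = sigma_sets UNIV (range atLeast)"
    using gen by simp_all
  show "emeasure M X = emeasure N X" if "X \<in> range atLeast" for X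
    using that eq by (auto simp: M.emeasure_eq_measure N.emeasure_eq_measure)
  show "Int_stable (range (atLeast :: real \<Rightarrow> _))"
  proof (rule Int_stableI)
    fix A B :: "real set"
    assume "A \<in> range atLeast" "B \<in> range atLeast"
    then obtain a b where "A = {a..}" "B = {b..}" by auto
    then have "A \<inter> B = {max a b..}" by auto
    then show "A \<inter> B \<in> range atLeast" by blast
  qed
  have "\<exists>n. - real n \<le> x" for x
    using real_arch_simple[of "- x"] by (auto simp: algebra_simps minus_le_iff)
  then show "(\<Union>n. {- real n..}) = UNIV" by auto
  show "emeasure M {- real n..} \<noteq> \<infinity>" for n
    by (simp add: M.emeasure_eq_measure)
qed auto

section \<open>A random contraction and its transition operator\<close>

text \<open>
  \<open>affine_step \<theta> g \<nu>\<close> is the law of \<open>U powr (1 / \<theta>) * g X\<close> for \<open>X\<close> of law \<open>\<nu>\<close>, and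
  \<open>transition\<close> is the dual operator on functions.
\<close>

definition affine_step :: "real \<Rightarrow> (real \<Rightarrow> real) \<Rightarrow> real measure \<Rightarrow> real measure" where
  "affine_step \<theta> g \<nu> = distr (unif01 \<Otimes>\<^sub>M \<nu>) borel (\<lambda>(u, t). u powr (1 / \<theta>) * g t)"

definition transition :: "real \<Rightarrow> (real \<Rightarrow> real) \<Rightarrow> (real \<Rightarrow> real) \<Rightarrow> real \<Rightarrow> real" where
  "transition \<theta> g f t = (\<integral>u. f (u powr (1 / \<theta>) * g t) \<partial>unif01)"

text \<open>
  The range of a utility function may be a bounded interval, so the maps \<open>g\<close> are taken on the whole
  line. The linear growth bound is what later controls the means.
\<close>

locale contractive_step =
  fixes \<theta> :: real and g :: "real \<Rightarrow> real"
  assumes theta_pos: "\<theta> > 0"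
    and mono_g: "mono g"
    and lipschitz_g: "\<And>x y. \<bar>g x - g y\<bar> \<le> \<bar>x - y\<bar>"
    and g_nonneg: "\<And>t. 0 \<le> g t"
    and g_growth: "\<And>t. g t \<le> max 0 t + 1"
begin

definition c :: real where "c = \<theta> / (\<theta> + 1)"

lemma c_bounds: "0 < c" "c < 1"
  using theta_pos by (auto simp: c_def field_simps)

lemma measurable_g [measurable]: "g \<in> borel_measurable borel"
  using mono_g by (rule borel_measurable_mono)

lemma integral_powr: "(\<integral>u. u powr (1 / \<theta>) \<partial>unif01) = c"
  unfolding c_def by (rule integral_unif01_powr[OF theta_pos])

lemma integrable_powr: "integrable unif01 (\<lambda>u. u powr (1 / \<theta>))"
proof -
  interpret prob_space unif01 by (rule prob_space_unif01)
  show ?thesis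
    using powr_in_unit_interval[OF theta_pos] by (intro integrable_const_bound[of _ 1]) auto
qed

lemma transition_integrable:
  "test_function L f \<Longrightarrow> integrable unif01 (\<lambda>u. f (u powr (1 / \<theta>) * a))"
  by (rule test_function_integrable[OF _ prob_space_unif01]) measurable

text \<open>
  Since \<open>g\<close> does not expand distances, the uniform factor shrinks the Lipschitz constant by its
  mean \<open>c\<close>.
\<close>

lemma test_function_transition:
  assumes f: "test_function L f"
  shows "test_function (c * L) (transition \<theta> g f)"
proof -
  interpret prob_space unif01 by (rule prob_space_unif01)
  note int = transition_integrable[OF f]
  have "mono (transition \<theta> g f)"
  proof (rule monoI)
    fix x y :: real assume "x \<le> y"
    then have "g x \<le> g y" using mono_g by (rule monoD[rotated])
    then show "transition \<theta> g f x \<le> transition \<theta> g f y"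
      unfolding transition_def using f
      by (intro integral_mono int) (auto simp: test_function_def intro!: monoD[of f] mult_left_mono)
  qed
  moreover have "0 \<le> transition \<theta> g f x \<and> transition \<theta> g f x \<le> 1" for x
    unfolding transition_def using f int
    by (auto simp: test_function_def intro!: integral_nonneg integral_le_const)
  moreover have "\<bar>transition \<theta> g f x - transition \<theta> g f y\<bar> \<le> c * L * \<bar>x - y\<bar>" for x y
  proof -
    have L: "0 \<le> L * \<bar>x - y\<bar>"
      using f unfolding test_function_def by (meson abs_ge_zero order_trans)
    have "\<bar>transition \<theta> g f x - transition \<theta> g f y\<bar>
        = \<bar>\<integral>u. f (u powr (1 / \<theta>) * g x) - f (u powr (1 / \<theta>) * g y) \<partial>unif01\<bar>"
      unfolding transition_def by (subst Bochner_Integration.integral_diff) (auto intro: int)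
    also have "\<dots> \<le> (\<integral>u. \<bar>f (u powr (1 / \<theta>) * g x) - f (u powr (1 / \<theta>) * g y)\<bar> \<partial>unif01)"
      by (rule integral_abs_bound)
    also have "\<dots> \<le> (\<integral>u. u powr (1 / \<theta>) * (L * \<bar>x - y\<bar>) \<partial>unif01)"
    proof (intro integral_mono integrable_abs Bochner_Integration.integrable_diff int
        integrable_mult_left integrable_powr)
      fix u
      have "\<bar>f (u powr (1 / \<theta>) * g x) - f (u powr (1 / \<theta>) * g y)\<bar>
          \<le> L * \<bar>u powr (1 / \<theta>) * g x - u powr (1 / \<theta>) * g y\<bar>"
        using f by (simp add: test_function_def)
      also have "\<dots> = u powr (1 / \<theta>) * (L * \<bar>g x - g y\<bar>)"
        by (simp add: right_diff_distrib[symmetric] abs_mult)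
      also have "L * \<bar>g x - g y\<bar> \<le> L * \<bar>x - y\<bar>"
      proof (cases "L \<ge> 0")
        case True
        then show ?thesis using lipschitz_g by (intro mult_left_mono)
      next
        case False
        with L have "x = y" by (auto simp: zero_le_mult_iff)
        then show ?thesis by simp
      qed
      finally show "\<bar>f (u powr (1 / \<theta>) * g x) - f (u powr (1 / \<theta>) * g y)\<bar>
          \<le> u powr (1 / \<theta>) * (L * \<bar>x - y\<bar>)"
        by (simp add: mult_left_mono)
    qed
    also have "\<dots> = c * L * \<bar>x - y\<bar>"
      by (simp add: integral_powr)
    finally show ?thesis .
  qed
  ultimately show ?thesis by (simp add: test_function_def)
qed

lemma test_function_iterate:
  "test_function L f \<Longrightarrow> test_function (c ^ n * L) ((transition \<theta> g ^^ n) f)"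
  by (induction n) (auto dest: test_function_transition simp: mult.assoc)

text \<open>
  The function \<open>\<lambda>t. max 0 t - \<theta>\<close> is a super-eigenfunction of the transition operator for the
  eigenvalue \<open>c\<close>, because \<open>c * (t + 1) - \<theta> = c * (t - \<theta>)\<close>.
\<close>

lemma iterate_le_linear:
  assumes f: "test_function L f" and a: "0 \<le> a" and le: "\<And>t. f t \<le> a * max 0 t"
  shows "(transition \<theta> g ^^ n) f t \<le> a * (c ^ n * (max 0 t - \<theta>) + \<theta>)"
proof (induction n arbitrary: t)
  case 0
  then show ?case using le by simp
next
  case (Suc n)
  interpret prob_space unif01 by (rule prob_space_unif01)
  define F where "F = (transition \<theta> g ^^ n) f"
  have F: "test_function (c ^ n * L) F"
    unfolding F_def by (rule test_function_iterate[OF f])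
  have "transition \<theta> g F t \<le> (\<integral>u. u powr (1 / \<theta>) * (a * c ^ n * g t) + a * (\<theta> - c ^ n * \<theta>) \<partial>unif01)"
    unfolding transition_def
  proof (intro integral_mono transition_integrable[OF F])
    fix u
    show "F (u powr (1 / \<theta>) * g t) \<le> u powr (1 / \<theta>) * (a * c ^ n * g t) + a * (\<theta> - c ^ n * \<theta>)"
      using Suc[of "u powr (1 / \<theta>) * g t"] g_nonneg[of t]
      by (simp add: F_def max_def algebra_simps split: if_splits)
    show "integrable unif01 (\<lambda>u. u powr (1 / \<theta>) * (a * c ^ n * g t) + a * (\<theta> - c ^ n * \<theta>))"
      by (intro Bochner_Integration.integrable_add integrable_mult_left integrable_powr
          integrable_const)
  qed
  also have "\<dots> = c * (a * c ^ n * g t) + a * (\<theta> - c ^ n * \<theta>)"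
    using integrable_powr by (simp add: integral_powr prob_space[unfolded space_unif01])
  also have "\<dots> \<le> c * (a * c ^ n * (max 0 t + 1)) + a * (\<theta> - c ^ n * \<theta>)"
    using c_bounds a g_growth[of t] by (intro add_right_mono mult_left_mono) auto
  also have "\<dots> = a * (c ^ n * (c * max 0 t + (c - \<theta>)) + \<theta>)"
    by (simp add: algebra_simps)
  also have "c - \<theta> = - (c * \<theta>)"
    using theta_pos by (simp add: c_def field_simps)
  also have "a * (c ^ n * (c * max 0 t + - (c * \<theta>)) + \<theta>) = a * (c ^ Suc n * (max 0 t - \<theta>) + \<theta>)"
    by (simp add: algebra_simps)
  finally show ?case by (simp add: F_def)
qed

lemma measurable_step:
  assumes "sets \<nu> = sets borel"
  shows "(\<lambda>(u, t). u powr (1 / \<theta>) * g t) \<in> borel_measurable (unif01 \<Otimes>\<^sub>M \<nu>)"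
proof -
  note [measurable_cong] = assms
  have [measurable]: "(\<lambda>u. u powr (1 / \<theta>)) \<in> borel_measurable unif01" by measurable
  have "(\<lambda>x. fst x powr (1 / \<theta>)) \<in> borel_measurable (unif01 \<Otimes>\<^sub>M \<nu>)"
    by (rule measurable_compose[OF measurable_fst]) measurable
  then show ?thesis by (simp add: case_prod_beta)
qed

lemma real_distribution_affine_step:
  assumes "real_distribution \<nu>"
  shows "real_distribution (affine_step \<theta> g \<nu>)"
proof -
  interpret real_distribution \<nu> by fact
  interpret U: prob_space unif01 by (rule prob_space_unif01)
  interpret pair_prob_space unif01 \<nu> ..
  interpret D: prob_space "affine_step \<theta> g \<nu>"
    unfolding affine_step_def by (rule prob_space_distr[OF measurable_step]) simp
  show ?thesis
    by unfold_locales (simp_all add: affine_step_def)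
qed

lemma integral_affine_step:
  assumes "real_distribution \<nu>" and f: "test_function L f"
  shows "(\<integral>t. f t \<partial>affine_step \<theta> g \<nu>) = (\<integral>t. transition \<theta> g f t \<partial>\<nu>)"
proof -
  interpret real_distribution \<nu> by fact
  interpret U: prob_space unif01 by (rule prob_space_unif01)
  interpret P: pair_prob_space unif01 \<nu> ..
  have step: "(\<lambda>(u, t). u powr (1 / \<theta>) * g t) \<in> borel_measurable (unif01 \<Otimes>\<^sub>M \<nu>)"
    by (rule measurable_step) simp
  have "integrable (unif01 \<Otimes>\<^sub>M \<nu>) (\<lambda>x. f (case x of (u, t) \<Rightarrow> u powr (1 / \<theta>) * g t))"
    by (rule test_function_integrable[OF f P.prob_space_axioms step])
  then have int: "integrable (unif01 \<Otimes>\<^sub>M \<nu>) (\<lambda>(u, t). f (u powr (1 / \<theta>) * g t))"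
    by (simp only: case_prod_unfold)
  have "(\<integral>t. f t \<partial>affine_step \<theta> g \<nu>)
      = (\<integral>x. f (case x of (u, t) \<Rightarrow> u powr (1 / \<theta>) * g t) \<partial>(unif01 \<Otimes>\<^sub>M \<nu>))"
    unfolding affine_step_def by (rule integral_distr[OF step test_function_measurable[OF f]])
  also have "\<dots> = (\<integral>(u, t). f (u powr (1 / \<theta>) * g t) \<partial>(unif01 \<Otimes>\<^sub>M \<nu>))"
    by (simp only: case_prod_unfold)
  also have "\<dots> = (\<integral>t. transition \<theta> g f t \<partial>\<nu>)"
    unfolding transition_def by (rule P.integral_snd[OF int, symmetric])
  finally show ?thesis .
qed

text \<open>
  The iterates flatten every test function, so the starting law is forgotten. Boundedness of the
  test functions gives the dominated convergence also when \<open>\<nu>\<close> has no mean.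
\<close>

lemma iterate_forgets_start:
  assumes "real_distribution \<nu>" and f: "test_function L f"
  shows "(\<lambda>n. (\<integral>t. (transition \<theta> g ^^ n) f t \<partial>\<nu>) - (transition \<theta> g ^^ n) f 0) \<longlonglongrightarrow> 0"
proof -
  interpret real_distribution \<nu> by fact
  define F where "F n = (transition \<theta> g ^^ n) f" for n
  have F: "test_function (c ^ n * L) (F n)" for n
    unfolding F_def by (rule test_function_iterate[OF f])
  note [measurable] = test_function_measurable[OF F]
  have "(\<lambda>n. F n t - F n 0) \<longlonglongrightarrow> 0" for t
  proof (rule Lim_null_comparison)
    show "\<forall>\<^sub>F n in sequentially. norm (F n t - F n 0) \<le> c ^ n * (L * \<bar>t\<bar>)"
    proof (rule always_eventually, rule allI)
      fix n
      have "\<bar>F n t - F n 0\<bar> \<le> c ^ n * L * \<bar>t - 0\<bar>"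
        using F[of n] unfolding test_function_def by blast
      then show "norm (F n t - F n 0) \<le> c ^ n * (L * \<bar>t\<bar>)"
        by (simp add: mult.assoc)
    qed
    show "(\<lambda>n. c ^ n * (L * \<bar>t\<bar>)) \<longlonglongrightarrow> 0"
      using c_bounds by (intro tendsto_mult_left_zero LIMSEQ_power_zero) auto
  qed
  then have "(\<lambda>n. \<integral>t. F n t - F n 0 \<partial>\<nu>) \<longlonglongrightarrow> (\<integral>t. 0 \<partial>\<nu>)"
  proof (intro integral_dominated_convergence[where w = "\<lambda>_. 1"])
    show "AE t in \<nu>. norm (F n t - F n 0) \<le> 1" for n
      using F[of n] by (auto simp: test_function_def abs_le_iff intro!: AE_I2)
        (smt (verit))+
  qed auto
  moreover have "(\<integral>t. F n t - F n 0 \<partial>\<nu>) = (\<integral>t. F n t \<partial>\<nu>) - F n 0" for n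
    using test_function_integrable[OF F prob_space_axioms, of "\<lambda>t. t" n]
    by (subst Bochner_Integration.integral_diff) (auto simp: prob_space[unfolded space_eq_univ])
  ultimately show ?thesis by (simp add: F_def)
qed

lemma integral_iterate_fixed:
  assumes "real_distribution \<nu>" and fixed: "affine_step \<theta> g \<nu> = \<nu>" and f: "test_function L f"
  shows "(\<integral>t. (transition \<theta> g ^^ n) f t \<partial>\<nu>) = (\<integral>t. f t \<partial>\<nu>)"
proof (induction n)
  case (Suc n)
  then show ?case
    using integral_affine_step[OF assms(1) test_function_iterate[OF f], of n] by (simp add: fixed)
qed simp

text \<open>
  The limit does not mention \<open>\<nu>\<close>, so two fixed laws have the same integrals of test functions.
\<close>

lemma fixed_law_integral_tendsto:
  assumes "real_distribution \<nu>" and fixed: "affine_step \<theta> g \<nu> = \<nu>" and f: "test_function L f"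
  shows "(\<lambda>n. (transition \<theta> g ^^ n) f 0) \<longlonglongrightarrow> (\<integral>t. f t \<partial>\<nu>)"
proof -
  have "(\<lambda>n. (\<integral>t. f t \<partial>\<nu>) - ((\<integral>t. f t \<partial>\<nu>) - (transition \<theta> g ^^ n) f 0)) \<longlonglongrightarrow> (\<integral>t. f t \<partial>\<nu>) - 0"
    using iterate_forgets_start[OF assms(1) f]
    by (intro tendsto_diff tendsto_const) (simp add: integral_iterate_fixed[OF assms])
  then show ?thesis by simp
qed

end

text \<open>
  The iterates for \<open>g\<close> and \<open>h\<close> are ordered pointwise because test functions are monotone; the
  order passes to the limits at \<open>0\<close>, which are the integrals under the fixed laws. With
  \<open>g = h\<close> this is uniqueness.
\<close>

lemma fixed_law_mono:
  assumes "contractive_step \<theta> g" "contractive_step \<theta> h" and le: "\<And>t. g t \<le> h t"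
    and \<nu>: "real_distribution \<nu>" "affine_step \<theta> g \<nu> = \<nu>"
    and \<rho>: "real_distribution \<rho>" "affine_step \<theta> h \<rho> = \<rho>"
  shows "measure \<nu> {a..} \<le> measure \<rho> {a..}"
proof (rule measure_atLeast_le[OF \<nu>(1) \<rho>(1)])
  interpret G: contractive_step \<theta> g by fact
  interpret H: contractive_step \<theta> h by fact
  interpret prob_space unif01 by (rule prob_space_unif01)
  fix L f assume f: "test_function L f"
  have "(transition \<theta> g ^^ n) f t \<le> (transition \<theta> h ^^ n) f t" for n t
  proof (induction n arbitrary: t)
    case (Suc n)
    note Gn = G.test_function_iterate[OF f, of n] and Hn = H.test_function_iterate[OF f, of n]
    have "(transition \<theta> g ^^ n) f (u powr (1 / \<theta>) * g t)
        \<le> (transition \<theta> h ^^ n) f (u powr (1 / \<theta>) * h t)" for u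
    proof -
      have "u powr (1 / \<theta>) * g t \<le> u powr (1 / \<theta>) * h t"
        using le by (simp add: mult_left_mono)
      then show ?thesis
        using Suc Gn by (meson monoD order_trans test_function_def)
    qed
    then show ?case
      unfolding funpow.simps comp_apply transition_def[of _ _ "(transition _ _ ^^ n) f"]
      by (intro integral_mono G.transition_integrable[OF Gn] H.transition_integrable[OF Hn])
  qed simp
  then show "(\<integral>t. f t \<partial>\<nu>) \<le> (\<integral>t. f t \<partial>\<rho>)"
    by (intro LIMSEQ_le[OF G.fixed_law_integral_tendsto[OF \<nu> f] H.fixed_law_integral_tendsto[OF \<rho> f]]) auto
qed

section \<open>Existence of a fixed law\<close>

text \<open>
  The chain started at \<open>0\<close>; its laws accumulate at a fixed law.
\<close>

definition step_law :: "real \<Rightarrow> (real \<Rightarrow> real) \<Rightarrow> nat \<Rightarrow> real measure" where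
  "step_law \<theta> g n = (affine_step \<theta> g ^^ n) (return borel 0)"

context contractive_step
begin

lemma real_distribution_step_law: "real_distribution (step_law \<theta> g n)"
proof (induction n)
  case 0
  have "prob_space (return borel (0 :: real))"
    by (rule prob_space_return) simp
  then show ?case
    by (simp add: step_law_def real_distribution_def real_distribution_axioms_def)
next
  case (Suc n)
  then show ?case
    using real_distribution_affine_step by (simp add: step_law_def)
qed

text \<open>
  The induction runs over all test functions at once: averaging over the last step replaces
  \<open>f\<close> by its transition.
\<close>

lemma integral_step_law:
  assumes "test_function L f"
  shows "(\<integral>t. f t \<partial>step_law \<theta> g n) = (transition \<theta> g ^^ n) f 0"
  using assms
proof (induction n arbitrary: L f)
  case 0
  then show ?case
    by (simp add: step_law_def integral_return test_function_measurable)
next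
  case (Suc n)
  have "(\<integral>t. f t \<partial>step_law \<theta> g (Suc n)) = (\<integral>t. transition \<theta> g f t \<partial>step_law \<theta> g n)"
    using integral_affine_step[OF real_distribution_step_law Suc.prems] by (simp add: step_law_def)
  also have "\<dots> = (transition \<theta> g ^^ n) (transition \<theta> g f) 0"
    by (rule Suc.IH[OF test_function_transition[OF Suc.prems]])
  finally show ?case by (simp add: funpow_swap1)
qed

lemma affine_step_nonneg:
  assumes "real_distribution \<nu>"
  shows "AE t in affine_step \<theta> g \<nu>. 0 \<le> t"
proof -
  interpret real_distribution \<nu> by fact
  show ?thesis
    unfolding affine_step_def using g_nonneg
    by (subst AE_distr_iff[OF measurable_step]) (auto intro!: AE_I2)
qed

lemma step_law_nonneg: "AE t in step_law \<theta> g n. 0 \<le> t"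
proof (cases n)
  case 0
  have "AE t in return borel (0 :: real). 0 \<le> t"
    by (subst AE_return) auto
  then show ?thesis by (simp only: 0 step_law_def funpow_0)
next
  case (Suc m)
  then have "step_law \<theta> g n = affine_step \<theta> g (step_law \<theta> g m)"
    by (simp add: step_law_def)
  then show ?thesis
    using affine_step_nonneg[OF real_distribution_step_law, of m] by (simp only:)
qed

text \<open>
  A Markov inequality with the ramp \<open>min 1 (t / K)\<close> in place of the indicator: the linear bound
  on the iterates keeps all means below \<open>\<theta>\<close>.
\<close>

lemma tight_step_law: "tight (step_law \<theta> g)"
  unfolding tight_def
proof (intro conjI allI impI real_distribution_step_law)
  fix \<epsilon> :: real assume "\<epsilon> > 0"
  \<comment> \<open>Any \<open>K\<close> with \<open>\<theta> / K < \<epsilon>\<close> works.\<close>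
  define K where "K = (\<theta> + 1) / \<epsilon>"
  have K: "K > 0" using theta_pos \<open>\<epsilon> > 0\<close> by (simp add: K_def)
  have "1 - \<epsilon> < measure (step_law \<theta> g n) {-1<..K}" for n
  proof -
    interpret real_distribution "step_law \<theta> g n" by (rule real_distribution_step_law)
    have ramp: "test_function (1 / K) (ramp (1 / K) K)"
      using K by (intro test_function_ramp) simp
    have "measure (step_law \<theta> g n) {K<..} = (\<integral>t. indicator {K<..} t \<partial>step_law \<theta> g n)"
      by simp
    also have "\<dots> \<le> (\<integral>t. ramp (1 / K) K t \<partial>step_law \<theta> g n)"
    proof (intro integral_mono test_function_integrable[OF ramp prob_space_axioms])
      show "integrable (step_law \<theta> g n) (indicator {K<..} :: real \<Rightarrow> real)"
        by (rule integrable_const_bound[of _ 1]) (auto simp: indicator_def)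
    qed (use K in \<open>auto simp: ramp_def indicator_def field_simps\<close>)
    also have "\<dots> = (transition \<theta> g ^^ n) (ramp (1 / K) K) 0"
      by (rule integral_step_law[OF ramp])
    also have "\<dots> \<le> 1 / K * (c ^ n * (max 0 0 - \<theta>) + \<theta>)"
      using K by (intro iterate_le_linear[OF ramp _ ramp_le_linear[OF K]]) simp
    also have "\<dots> \<le> 1 / K * \<theta>"
      using K c_bounds theta_pos by (intro mult_left_mono) auto
    also have "\<dots> < \<epsilon>"
      using theta_pos \<open>\<epsilon> > 0\<close> by (simp add: K_def field_simps)
    finally have tail: "measure (step_law \<theta> g n) {K<..} < \<epsilon>" .
    have "AE t in step_law \<theta> g n. t \<in> {0..}"
      using step_law_nonneg by simp
    then have "measure (step_law \<theta> g n) {0..} = 1"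
      by (subst (asm) AE_in_set_eq_1) simp_all
    then have "1 = measure (step_law \<theta> g n) {0..}"
      by (rule sym)
    also have "\<dots> \<le> measure (step_law \<theta> g n) ({-1<..K} \<union> {K<..})"
      by (intro finite_measure_mono) auto
    also have "\<dots> \<le> measure (step_law \<theta> g n) {-1<..K} + measure (step_law \<theta> g n) {K<..}"
      by (intro measure_Un_le) auto
    finally show ?thesis using tail by simp
  qed
  then show "\<exists>a b. a < b \<and> (\<forall>n. 1 - \<epsilon> < measure (step_law \<theta> g n) {a<..b})"
    using K by (intro exI[of _ "-1"] exI[of _ K]) auto
qed

text \<open>
  A weak subsequential limit \<open>\<nu>\<close> of the chain is fixed: along the subsequence, the integrals of a
  test function after \<open>r n\<close> and after \<open>r n + 1\<close> steps have the same limit.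
\<close>

lemma fixed_law_exists: "\<exists>\<nu>. real_distribution \<nu> \<and> affine_step \<theta> g \<nu> = \<nu>"
proof -
  obtain r \<nu> where r: "strict_mono (r :: nat \<Rightarrow> nat)" and \<nu>: "real_distribution \<nu>"
    and "weak_conv_m (step_law \<theta> g \<circ> id \<circ> r) \<nu>"
    using tight_imp_convergent_subsubsequence[OF tight_step_law strict_mono_id] by blast
  then have conv: "weak_conv_m (\<lambda>n. step_law \<theta> g (r n)) \<nu>"
    by (simp add: comp_def)
  have lim: "(\<lambda>n. (transition \<theta> g ^^ r n) f 0) \<longlonglongrightarrow> (\<integral>t. f t \<partial>\<nu>)" if f: "test_function L f" for L f
  proof -
    have "(\<lambda>n. \<integral>t. f t \<partial>step_law \<theta> g (r n)) \<longlonglongrightarrow> (\<integral>t. f t \<partial>\<nu>)"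
      using f
      by (intro weak_conv_imp_integral_bdd_continuous_conv[where B = 1, OF real_distribution_step_law \<nu> conv]
          test_function_isCont[OF f]) (auto simp: test_function_def)
    then show ?thesis by (simp add: integral_step_law[OF f])
  qed
  have "affine_step \<theta> g \<nu> = \<nu>"
  proof (intro law_eqI_atLeast antisym measure_atLeast_le real_distribution_affine_step \<nu>)
    fix L f assume f: "test_function L f"
    have "(\<lambda>n. (transition \<theta> g ^^ r n) (transition \<theta> g f) 0) \<longlonglongrightarrow> (\<integral>t. f t \<partial>affine_step \<theta> g \<nu>)"
      using lim[OF test_function_transition[OF f]] by (simp add: integral_affine_step[OF \<nu> f])
    \<comment> \<open>One more step at the beginning is a different starting law, which the iterates forget.\<close>
    moreover have "(\<lambda>n. (transition \<theta> g ^^ r n) (transition \<theta> g f) 0 - (transition \<theta> g ^^ r n) f 0)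
        \<longlonglongrightarrow> 0"
    proof -
      have "(\<integral>t. (transition \<theta> g ^^ n) f t \<partial>step_law \<theta> g 1) = (transition \<theta> g ^^ n) (transition \<theta> g f) 0" for n
        using integral_step_law[OF test_function_iterate[OF f], of 1 n] by (simp add: funpow_swap1)
      then have "(\<lambda>n. (transition \<theta> g ^^ n) (transition \<theta> g f) 0 - (transition \<theta> g ^^ n) f 0) \<longlonglongrightarrow> 0"
        using iterate_forgets_start[OF real_distribution_step_law f, of 1] by simp
      from LIMSEQ_subseq_LIMSEQ[OF this r] show ?thesis by (simp add: comp_def)
    qed
    ultimately have "(\<lambda>n. (transition \<theta> g ^^ r n) f 0) \<longlonglongrightarrow> (\<integral>t. f t \<partial>affine_step \<theta> g \<nu>)"
      by (rule Lim_transform2)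
    then have "(\<integral>t. f t \<partial>affine_step \<theta> g \<nu>) = (\<integral>t. f t \<partial>\<nu>)"
      using lim[OF f] by (rule LIMSEQ_unique)
    then show "(\<integral>t. f t \<partial>affine_step \<theta> g \<nu>) \<le> (\<integral>t. f t \<partial>\<nu>)"
      "(\<integral>t. f t \<partial>\<nu>) \<le> (\<integral>t. f t \<partial>affine_step \<theta> g \<nu>)"
      by simp_all
  qed
  with \<nu> show ?thesis by blast
qed

text \<open>
  The truncations \<open>min K t\<close> have integral at most \<open>\<theta>\<close> by the linear bound on the iterates.
\<close>

lemma fixed_law_finite_mean:
  assumes "real_distribution \<nu>" and fixed: "affine_step \<theta> g \<nu> = \<nu>"
  shows "integrable \<nu> (\<lambda>t. t)"
proof -
  interpret real_distribution \<nu> by fact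
  define h where "h K t = min (real (Suc K)) (max 0 t)" for K t
  have h: "h K t = real (Suc K) * ramp (1 / real (Suc K)) (real (Suc K)) t" for K t
    using mult_ramp[of "real (Suc K)" t] by (simp add: h_def)
  have [measurable]: "h K \<in> borel_measurable borel" for K
    unfolding h_def[abs_def] by measurable
  have bound: "(\<integral>t. h K t \<partial>\<nu>) \<le> \<theta>" for K
  proof -
    define k where "k = real (Suc K)"
    have k: "k > 0" by (simp add: k_def)
    have ramp: "test_function (1 / k) (ramp (1 / k) k)"
      using k by (intro test_function_ramp) simp
    have "(transition \<theta> g ^^ n) (ramp (1 / k) k) 0 \<le> 1 / k * \<theta>" for n
    proof -
      have "(transition \<theta> g ^^ n) (ramp (1 / k) k) 0 \<le> 1 / k * (c ^ n * (max 0 0 - \<theta>) + \<theta>)"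
        using k by (intro iterate_le_linear[OF ramp _ ramp_le_linear[OF k]]) simp
      also have "\<dots> \<le> 1 / k * \<theta>"
        using k c_bounds theta_pos by (intro mult_left_mono) auto
      finally show ?thesis .
    qed
    then have "(\<integral>t. ramp (1 / k) k t \<partial>\<nu>) \<le> 1 / k * \<theta>"
      by (intro LIMSEQ_le_const2[OF fixed_law_integral_tendsto[OF assms ramp]]) auto
    moreover have "h K = (\<lambda>t. k * ramp (1 / k) k t)"
      by (intro ext) (simp only: h k_def)
    ultimately show ?thesis
      using k by (simp add: field_simps)
  qed
  have "(\<integral>\<^sup>+t. ennreal (max 0 t) \<partial>\<nu>) = (\<integral>\<^sup>+t. (SUP K. ennreal (h K t)) \<partial>\<nu>)"
  proof (rule nn_integral_cong, rule antisym)
    fix t :: real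
    obtain K :: nat where "max 0 t \<le> real K" using real_arch_simple by blast
    then have "max 0 t = h K t" by (simp add: h_def)
    then show "ennreal (max 0 t) \<le> (SUP K. ennreal (h K t))"
      by (metis SUP_upper UNIV_I)
    show "(SUP K. ennreal (h K t)) \<le> ennreal (max 0 t)"
      by (intro SUP_least ennreal_leI) (simp add: h_def)
  qed
  also have "\<dots> = (SUP K. \<integral>\<^sup>+t. ennreal (h K t) \<partial>\<nu>)"
    by (intro nn_integral_monotone_convergence_SUP incseq_SucI le_funI ennreal_leI)
       (auto simp: h_def)
  also have "\<dots> \<le> ennreal \<theta>"
  proof (rule SUP_least)
    fix K
    have "integrable \<nu> (h K)"
      by (rule integrable_const_bound[of _ "real (Suc K)"]) (auto simp: h_def)
    then have "(\<integral>\<^sup>+t. ennreal (h K t) \<partial>\<nu>) = ennreal (\<integral>t. h K t \<partial>\<nu>)"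
      by (rule nn_integral_eq_integral) (simp add: h_def)
    then show "(\<integral>\<^sup>+t. ennreal (h K t) \<partial>\<nu>) \<le> ennreal \<theta>"
      using bound by (simp add: ennreal_leI)
  qed
  finally have "integrable \<nu> (\<lambda>t. max 0 t)"
    by (intro integrableI_nonneg) (auto simp: le_less_trans[OF _ ennreal_less_top])
  moreover have "AE t in \<nu>. max 0 t = t"
    using affine_step_nonneg[OF assms(1)] unfolding fixed by eventually_elim simp
  ultimately show ?thesis
    by (intro integrable_cong_AE_imp[of \<nu> "max 0" "\<lambda>t. t"]) auto
qed

lemma fixed_law_unique:
  assumes "real_distribution \<nu>" "affine_step \<theta> g \<nu> = \<nu>"
    and "real_distribution \<nu>'" "affine_step \<theta> g \<nu>' = \<nu>'"
  shows "\<nu> = \<nu>'"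
proof (rule law_eqI_atLeast)
  note mono = fixed_law_mono[OF contractive_step_axioms contractive_step_axioms order_refl]
  show "measure \<nu> {a..} = measure \<nu>' {a..}" for a
    by (rule antisym; rule mono; fact)
qed fact+

end

section \<open>The utility scale\<close>

text \<open>
  Passing from \<open>D\<close> to \<open>s D\<close> turns the fixed-point equation into a step
  \<open>t \<mapsto> U powr (1 / \<theta>) * s (s_inv t + 1)\<close>. The identity is the utility of the generalized Dickman
  distribution.
\<close>

locale dickman_utility =
  fixes \<theta> :: real and s :: "real \<Rightarrow> real"
  assumes theta_pos: "\<theta> > 0"
    and s_continuous: "continuous_on {0..} s"
    and s_strict_mono: "strict_mono_on {0..} s"
    and s_0: "s 0 = 0"
    and s_1: "s 1 = 1"
    and s_shift_contraction:
      "\<And>x y. x \<ge> 0 \<Longrightarrow> y \<ge> 0 \<Longrightarrow> \<bar>s (x + 1) - s (y + 1)\<bar> \<le> \<bar>s x - s y\<bar>"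
begin

lemma s_le_iff: "0 \<le> x \<Longrightarrow> 0 \<le> y \<Longrightarrow> s x \<le> s y \<longleftrightarrow> x \<le> y"
  by (rule strict_mono_on_less_eq[OF s_strict_mono]) auto

lemma s_nonneg: "0 \<le> x \<Longrightarrow> 0 \<le> s x"
  using s_le_iff[of 0 x] by (simp add: s_0)

text \<open>
  On the range of \<open>s\<close> the map \<open>s x \<mapsto> s (x + 1)\<close> is nondecreasing and \<open>1\<close>-Lipschitz. The
  infimum below is its one-sided McShane extension to the whole line, which keeps both properties
  also when \<open>s\<close> is bounded.
\<close>

definition shift :: "real \<Rightarrow> real" where
  "shift t = (INF y\<in>{0..}. s (y + 1) + max 0 (t - s y))"

lemma shift_bdd_below: "bdd_below ((\<lambda>y. s (y + 1) + max 0 (t - s y)) ` {0..})"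
  by (rule bdd_belowI2[of _ 0]) (auto intro!: add_nonneg_nonneg s_nonneg)

lemma shift_le: "0 \<le> y \<Longrightarrow> shift t \<le> s (y + 1) + max 0 (t - s y)"
  unfolding shift_def by (rule cINF_lower[OF shift_bdd_below]) simp

lemma shift_geI: "(\<And>y. 0 \<le> y \<Longrightarrow> a \<le> s (y + 1) + max 0 (t - s y)) \<Longrightarrow> a \<le> shift t"
  unfolding shift_def by (rule cINF_greatest) auto

lemma shift_s:
  assumes "0 \<le> x"
  shows "shift (s x) = s (x + 1)"
proof (rule antisym)
  show "shift (s x) \<le> s (x + 1)"
    using shift_le[OF assms, of "s x"] by simp
  show "s (x + 1) \<le> shift (s x)"
  proof (rule shift_geI)
    fix y :: real assume y: "0 \<le> y"
    show "s (x + 1) \<le> s (y + 1) + max 0 (s x - s y)"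
    proof (cases "x \<le> y")
      case True
      then have "s (x + 1) \<le> s (y + 1)" using assms y by (simp add: s_le_iff)
      then show ?thesis by simp
    next
      case False
      then have "s y \<le> s x" using assms y by (simp add: s_le_iff)
      then show ?thesis using s_shift_contraction[OF assms y] by simp
    qed
  qed
qed

text \<open>
  One inequality, \<open>shift x \<le> shift y + max 0 (x - y)\<close>, contains both monotonicity and the Lipschitz
  bound; the growth bound is the term \<open>y = 0\<close> of the infimum, where \<open>s 0 = 0\<close> and \<open>s 1 = 1\<close>.
\<close>

lemma contractive_shift: "contractive_step \<theta> shift"
proof
  have shift_add: "shift x \<le> shift y + max 0 (x - y)" for x y
  proof -
    have "shift x - max 0 (x - y) \<le> shift y"
    proof (rule shift_geI)
      fix z :: real assume "0 \<le> z"
      from shift_le[OF this, of x]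
      show "shift x - max 0 (x - y) \<le> s (z + 1) + max 0 (y - s z)"
        by linarith
    qed
    then show ?thesis by simp
  qed
  show "mono shift"
  proof (rule monoI)
    fix x y :: real assume "x \<le> y"
    then show "shift x \<le> shift y" using shift_add[of x y] by simp
  qed
  show "\<bar>shift x - shift y\<bar> \<le> \<bar>x - y\<bar>" for x y
    using shift_add[of x y] shift_add[of y x] by linarith
  show "0 \<le> shift t" for t
    by (intro shift_geI add_nonneg_nonneg s_nonneg) auto
  show "shift t \<le> max 0 t + 1" for t
    using shift_le[of 0 t] by (simp add: s_0 s_1)
qed (rule theta_pos)

sublocale step: contractive_step \<theta> shift
  by (rule contractive_shift)

text \<open>
  The part of the line above all values of \<open>s\<close>; it is empty for unbounded \<open>s\<close>. Integer arguments
  suffice as \<open>s\<close> is increasing, and they make measurability immediate.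
\<close>

definition above_range :: "real set" where
  "above_range = {t. \<forall>n::nat. s (real n) < t}"

lemma above_range_measurable [measurable]: "above_range \<in> sets borel"
  unfolding above_range_def by measurable

lemma above_range_iff: "t \<in> above_range \<longleftrightarrow> (\<forall>x\<ge>0. s x < t)"
proof
  assume t: "t \<in> above_range"
  show "\<forall>x\<ge>0. s x < t"
  proof (intro allI impI)
    fix x :: real assume "0 \<le> x"
    obtain n :: nat where "x \<le> real n" using real_arch_simple by blast
    with \<open>0 \<le> x\<close> have "s x \<le> s (real n)" by (simp add: s_le_iff)
    also have "\<dots> < t" using t by (simp add: above_range_def)
    finally show "s x < t" .
  qed
qed (simp add: above_range_def)

lemma in_range_s:
  assumes "0 \<le> t" "t \<notin> above_range"
  shows "t \<in> s ` {0..}"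
proof -
  obtain x where x: "0 \<le> x" "t \<le> s x"
    using assms(2) by (auto simp: above_range_iff not_less)
  have "continuous_on {0..x} s"
    by (rule continuous_on_subset[OF s_continuous]) auto
  then have "\<exists>y. 0 \<le> y \<and> y \<le> x \<and> s y = t"
    using x assms(1) by (intro IVT') (auto simp: s_0)
  then show ?thesis by auto
qed

lemma s_notin_above_range: "0 \<le> x \<Longrightarrow> s x \<notin> above_range"
  by (auto simp: above_range_iff)

text \<open>
  The inverse on the range of \<open>s\<close>, with the value \<open>0\<close> elsewhere to make it measurable on the whole
  line.
\<close>

definition s_inv :: "real \<Rightarrow> real" where
  "s_inv t = (if 0 \<le> t \<and> t \<notin> above_range then inv_into {0..} s t else 0)"

lemma inv_into_s: "0 \<le> x \<Longrightarrow> inv_into {0..} s (s x) = x"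
  by (rule inv_into_f_f[OF strict_mono_on_imp_inj_on[OF s_strict_mono]]) simp

lemma s_inv_s: "0 \<le> x \<Longrightarrow> s_inv (s x) = x"
  by (simp add: s_inv_def inv_into_s s_nonneg s_notin_above_range)

lemma s_s_inv: "0 \<le> t \<Longrightarrow> t \<notin> above_range \<Longrightarrow> s (s_inv t) = t"
  using in_range_s[of t] by (auto simp: s_inv_s)

lemma s_inv_nonneg: "0 \<le> s_inv t"
proof (cases "0 \<le> t \<and> t \<notin> above_range")
  case True
  then show ?thesis using in_range_s[of t] by (auto simp: s_inv_s)
qed (auto simp: s_inv_def)

text \<open>
  The inverse is monotone on the range and constant off it.
\<close>

lemma s_inv_measurable: "s_inv \<in> borel_measurable borel"
proof -
  let ?R = "{0..} - above_range"
  have "mono_on ?R s_inv"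
  proof (rule mono_onI)
    fix r t assume "r \<in> ?R" "t \<in> ?R" "r \<le> t"
    moreover obtain x y where "r = s x" "t = s y" "0 \<le> x" "0 \<le> y"
      using in_range_s[of r] in_range_s[of t] \<open>r \<in> ?R\<close> \<open>t \<in> ?R\<close> by auto
    ultimately show "s_inv r \<le> s_inv t" by (simp add: s_inv_s s_le_iff)
  qed
  then have "s_inv \<in> borel_measurable (restrict_space borel ?R)"
    by (rule borel_measurable_mono_on_fnc)
  then have "(\<lambda>t. indicator ?R t *\<^sub>R s_inv t) \<in> borel_measurable borel"
    by (subst (asm) borel_measurable_restrict_space_iff) auto
  moreover have "(\<lambda>t. indicator ?R t *\<^sub>R s_inv t) = s_inv"
    by (auto simp: s_inv_def indicator_def)
  ultimately show ?thesis by simp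
qed

section \<open>Transfer of laws between the two scales\<close>

lemma halfline_space [simp]: "space halfline = {0..}"
  by (simp add: halfline_def space_restrict_space)

lemma s_inv_halfline: "s_inv \<in> borel \<rightarrow>\<^sub>M halfline"
  unfolding halfline_def
  by (rule measurable_restrict_space2) (auto simp: s_inv_nonneg s_inv_measurable)

lemma s_measurable: "s \<in> borel_measurable halfline"
  unfolding halfline_def by (rule borel_measurable_continuous_on_restrict[OF s_continuous])

definition utility_step :: "real measure \<Rightarrow> real measure" where
  "utility_step \<mu> = distr (unif01 \<Otimes>\<^sub>M \<mu>) halfline
    (\<lambda>(u, d). inv_into {0..} s (u powr (1 / \<theta>) * s (d + 1)))"

text \<open>
  A starting point below some \<open>s y\<close> is moved below \<open>s (y + 1)\<close>.
\<close>

lemma scaled_notin_above_range: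
  assumes "u \<in> {0..1}" "t \<notin> above_range"
  shows "u powr (1 / \<theta>) * shift t \<notin> above_range"
proof -
  obtain y where y: "0 \<le> y" "t \<le> s y"
    using assms(2) by (auto simp: above_range_iff not_less)
  have "u powr (1 / \<theta>) * shift t \<le> 1 * shift t"
    using powr_in_unit_interval[OF theta_pos assms(1)] step.g_nonneg by (intro mult_right_mono)
  also have "\<dots> \<le> shift (s y)"
    using monoD[OF step.mono_g y(2)] by simp
  also have "\<dots> = s (y + 1)"
    using y(1) by (rule shift_s)
  finally have "\<not> s (y + 1) < u powr (1 / \<theta>) * shift t"
    by simp
  moreover have "0 \<le> y + 1" using y(1) by simp
  ultimately show ?thesis
    unfolding above_range_iff by blast
qed

lemma affine_step_notin_above_range:
  assumes "real_distribution \<nu>" and "AE t in \<nu>. t \<notin> above_range"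
  shows "AE t in affine_step \<theta> shift \<nu>. t \<notin> above_range"
proof -
  interpret real_distribution \<nu> by fact
  interpret U: prob_space unif01 by (rule prob_space_unif01)
  interpret P: pair_prob_space unif01 \<nu> ..
  have "AE x in unif01 \<Otimes>\<^sub>M \<nu>. snd x \<notin> above_range"
  proof (rule P.AE_pair_measure)
    show "AE u in unif01. AE t in \<nu>. snd (u, t) \<notin> above_range"
      using assms(2) by simp
  qed measurable
  then have "AE x in unif01 \<Otimes>\<^sub>M \<nu>. (case x of (u, t) \<Rightarrow> u powr (1 / \<theta>) * shift t) \<notin> above_range"
    using AE_space[of "unif01 \<Otimes>\<^sub>M \<nu>"]
  proof eventually_elim
    case (elim x)
    then have "fst x \<in> {0..1}" by (auto simp: space_pair_measure)
    then show ?case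
      using scaled_notin_above_range[OF _ elim(1)] by (simp add: case_prod_beta)
  qed
  then show ?thesis
    unfolding affine_step_def by (subst AE_distr_iff[OF step.measurable_step]) auto
qed

lemma nonneg_lawD:
  assumes "nonneg_law \<mu>"
  shows "prob_space \<mu>" "sets \<mu> = sets halfline" "space \<mu> = {0..}"
  using assms sets_eq_imp_space_eq[of \<mu> halfline] by (auto simp: nonneg_law_def)

lemma s_measurable_law: "nonneg_law \<mu> \<Longrightarrow> s \<in> borel_measurable \<mu>"
  using s_measurable by (simp add: measurable_cong_sets[OF nonneg_lawD(2) refl])

lemma real_distribution_s:
  assumes "nonneg_law \<mu>"
  shows "real_distribution (distr \<mu> borel s)"
proof -
  interpret prob_space \<mu> by (rule nonneg_lawD[OF assms])
  show ?thesis
    using s_measurable_law[OF assms] by (rule real_distribution_distr)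
qed

lemma nonneg_law_s_inv:
  assumes "real_distribution \<nu>"
  shows "nonneg_law (distr \<nu> halfline s_inv)"
proof -
  interpret real_distribution \<nu> by fact
  have "s_inv \<in> \<nu> \<rightarrow>\<^sub>M halfline"
    using s_inv_halfline by (simp add: measurable_cong_sets[OF events_eq_borel refl])
  then show ?thesis
    by (simp add: nonneg_law_def prob_space_distr)
qed

lemma s_law_in_range:
  assumes "nonneg_law \<mu>"
  shows "AE t in distr \<mu> borel s. t \<notin> above_range"
  using AE_space[of \<mu>]
  by (subst AE_distr_iff[OF s_measurable_law[OF assms]])
     (auto simp: nonneg_lawD[OF assms] intro!: AE_I2 s_notin_above_range)

lemma distr_s_inv_s:
  assumes "nonneg_law \<mu>"
  shows "distr (distr \<mu> borel s) halfline s_inv = \<mu>"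
proof -
  have "distr (distr \<mu> borel s) halfline s_inv = distr \<mu> halfline (s_inv \<circ> s)"
    by (rule distr_distr[OF s_inv_halfline s_measurable_law[OF assms]])
  also have "\<dots> = distr \<mu> \<mu> (\<lambda>d. d)"
    by (intro distr_cong) (auto simp: nonneg_lawD[OF assms] s_inv_s)
  finally show ?thesis by (simp only: distr_id2[OF refl])
qed

lemma distr_s_s_inv:
  assumes "real_distribution \<nu>" and "AE t in \<nu>. 0 \<le> t" and "AE t in \<nu>. t \<notin> above_range"
  shows "distr (distr \<nu> halfline s_inv) borel s = \<nu>"
proof -
  interpret real_distribution \<nu> by fact
  have s_inv: "s_inv \<in> \<nu> \<rightarrow>\<^sub>M halfline"
    using s_inv_halfline by (simp add: measurable_cong_sets[OF events_eq_borel refl])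
  have "distr (distr \<nu> halfline s_inv) borel s = distr \<nu> borel (s \<circ> s_inv)"
    by (rule distr_distr[OF s_measurable s_inv])
  also have "\<dots> = distr \<nu> \<nu> (\<lambda>t. t)"
  proof (rule distr_cong_AE)
    show "AE t in \<nu>. (s \<circ> s_inv) t = t"
      using assms(2,3) by eventually_elim (simp add: s_s_inv)
    show "s \<circ> s_inv \<in> \<nu> \<rightarrow>\<^sub>M borel"
      by (rule measurable_comp[OF s_inv s_measurable])
  qed auto
  finally show ?thesis by (simp only: distr_id2[OF refl])
qed

lemma utility_step_eq_affine_step:
  assumes "nonneg_law \<mu>"
  shows "utility_step \<mu> = distr (affine_step \<theta> shift (distr \<mu> borel s)) halfline s_inv"
proof -
  interpret S: real_distribution "distr \<mu> borel s" by (rule real_distribution_s[OF assms])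
  note s = s_measurable_law[OF assms]
  have pair: "(\<lambda>(u, d). (u, s d)) \<in> unif01 \<Otimes>\<^sub>M \<mu> \<rightarrow>\<^sub>M unif01 \<Otimes>\<^sub>M borel"
    using s by measurable
  have F: "(\<lambda>(u, t). u powr (1 / \<theta>) * shift t) \<in> borel_measurable (unif01 \<Otimes>\<^sub>M borel)"
    by (rule step.measurable_step) simp
  have "unif01 \<Otimes>\<^sub>M distr \<mu> borel s = distr unif01 unif01 (\<lambda>u. u) \<Otimes>\<^sub>M distr \<mu> borel s"
    by (simp add: distr_id2)
  also have "\<dots> = distr (unif01 \<Otimes>\<^sub>M \<mu>) (unif01 \<Otimes>\<^sub>M borel) (\<lambda>(u, d). (u, s d))"
    using s by (intro pair_measure_distr S.sigma_finite_measure) simp_all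
  finally have "affine_step \<theta> shift (distr \<mu> borel s)
      = distr (unif01 \<Otimes>\<^sub>M \<mu>) borel ((\<lambda>(u, t). u powr (1 / \<theta>) * shift t) \<circ> (\<lambda>(u, d). (u, s d)))"
    unfolding affine_step_def by (simp only: distr_distr[OF F pair])
  then have "distr (affine_step \<theta> shift (distr \<mu> borel s)) halfline s_inv = distr (unif01 \<Otimes>\<^sub>M \<mu>) halfline
      (s_inv \<circ> ((\<lambda>(u, t). u powr (1 / \<theta>) * shift t) \<circ> (\<lambda>(u, d). (u, s d))))"
    by (simp only: distr_distr[OF s_inv_halfline measurable_comp[OF pair F]])
  also have "\<dots> = utility_step \<mu>"
    unfolding utility_step_def
  proof (intro distr_cong refl)
    fix x assume "x \<in> space (unif01 \<Otimes>\<^sub>M \<mu>)"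
    then obtain u d where x: "x = (u, d)" and u: "u \<in> {0..1}" and d: "0 \<le> d"
      by (auto simp: space_pair_measure nonneg_lawD[OF assms])
    have "0 \<le> u powr (1 / \<theta>) * s (d + 1)"
      using d by (intro mult_nonneg_nonneg s_nonneg) auto
    moreover have "u powr (1 / \<theta>) * s (d + 1) \<notin> above_range"
      using scaled_notin_above_range[OF u s_notin_above_range[OF d]] by (simp add: shift_s d)
    ultimately show "(s_inv \<circ> ((\<lambda>(u, t). u powr (1 / \<theta>) * shift t) \<circ> (\<lambda>(u, d). (u, s d)))) x
        = (case x of (u, d) \<Rightarrow> inv_into {0..} s (u powr (1 / \<theta>) * s (d + 1)))"
      using d by (simp add: x shift_s s_inv_def)
  qed
  finally show ?thesis by simp
qed

text \<open>
  The step on the original scale is the conjugate by \<open>s\<close> of the affine step. Because \<open>s_inv\<close> inverts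
  \<open>s\<close> only on its range, the forward direction uses that the step law does not charge
  \<open>above_range\<close>.
\<close>

lemma utility_step_fixed_iff:
  assumes "nonneg_law \<mu>"
  shows "utility_step \<mu> = \<mu> \<longleftrightarrow> affine_step \<theta> shift (distr \<mu> borel s) = distr \<mu> borel s"
proof
  note S = real_distribution_s[OF assms]
  assume fixed: "utility_step \<mu> = \<mu>"
  have "distr (distr (affine_step \<theta> shift (distr \<mu> borel s)) halfline s_inv) borel s
      = affine_step \<theta> shift (distr \<mu> borel s)"
    by (intro distr_s_s_inv step.real_distribution_affine_step step.affine_step_nonneg
        affine_step_notin_above_range s_law_in_range S assms)
  then show "affine_step \<theta> shift (distr \<mu> borel s) = distr \<mu> borel s"
    by (simp only: utility_step_eq_affine_step[OF assms, symmetric] fixed)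
next
  assume "affine_step \<theta> shift (distr \<mu> borel s) = distr \<mu> borel s"
  then show "utility_step \<mu> = \<mu>"
    by (simp only: utility_step_eq_affine_step[OF assms] distr_s_inv_s[OF assms])
qed

lemma utility_law_unique:
  assumes "nonneg_law \<mu>" "utility_step \<mu> = \<mu>" "nonneg_law \<mu>'" "utility_step \<mu>' = \<mu>'"
  shows "\<mu> = \<mu>'"
proof -
  have "distr \<mu> borel s = distr \<mu>' borel s"
  proof (rule step.fixed_law_unique)
    show "affine_step \<theta> shift (distr \<mu> borel s) = distr \<mu> borel s"
      using assms(2) utility_step_fixed_iff[OF assms(1)] by blast
    show "affine_step \<theta> shift (distr \<mu>' borel s) = distr \<mu>' borel s"
      using assms(4) utility_step_fixed_iff[OF assms(3)] by blast
  qed (intro real_distribution_s assms)+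
  then have "distr (distr \<mu> borel s) halfline s_inv = distr (distr \<mu>' borel s) halfline s_inv"
    by (rule arg_cong)
  then show ?thesis
    by (simp only: distr_s_inv_s[OF assms(1)] distr_s_inv_s[OF assms(3)])
qed

end

section \<open>Existence of the utility law\<close>

lemma not_AE_unif01_greater:
  assumes "0 < \<delta>" "\<delta> \<le> 1"
  shows "\<not> (AE u in unif01. \<delta> < u)"
proof
  assume "AE u in unif01. \<delta> < u"
  then have "AE u in lborel. u \<in> {0..1} \<longrightarrow> \<delta> < u"
    unfolding unif01_def by (subst (asm) AE_restrict_space_iff) auto
  then have "AE u in lborel. u \<notin> {0..\<delta>}"
    using assms by (auto elim!: eventually_mono)
  then have "emeasure lborel {0..\<delta>} = 0"
    by (subst (asm) AE_iff_measurable[where N = "{0..\<delta>}"]) auto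
  then show False using assms by simp
qed

context dickman_utility
begin

text \<open>
  A step ends above the range of \<open>s\<close> only if it starts there, so stationarity forces a start above
  the range to end above it almost surely. But the uniform factor shrinks below any
  level with positive probability.
\<close>

lemma fixed_law_in_range:
  assumes "real_distribution \<nu>" and fixed: "affine_step \<theta> shift \<nu> = \<nu>"
  shows "AE t in \<nu>. t \<notin> above_range"
proof -
  interpret real_distribution \<nu> by fact
  interpret U: prob_space unif01 by (rule prob_space_unif01)
  interpret P: pair_prob_space unif01 \<nu> ..
  define F where "F = (\<lambda>(u, t). u powr (1 / \<theta>) * shift t)"
  have F [measurable]: "F \<in> borel_measurable (unif01 \<Otimes>\<^sub>M \<nu>)"
    unfolding F_def by (rule step.measurable_step) simp
  define start where "start = {x \<in> space (unif01 \<Otimes>\<^sub>M \<nu>). snd x \<in> above_range}"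
  define finish where "finish = {x \<in> space (unif01 \<Otimes>\<^sub>M \<nu>). F x \<in> above_range}"
  have sets: "start \<in> sets (unif01 \<Otimes>\<^sub>M \<nu>)" "finish \<in> sets (unif01 \<Otimes>\<^sub>M \<nu>)"
    unfolding start_def finish_def by measurable
  have sub: "finish \<subseteq> start"
    using scaled_notin_above_range
    by (force simp: start_def finish_def F_def space_pair_measure)
  have "start = space unif01 \<times> above_range"
    by (auto simp: start_def space_pair_measure)
  then have "emeasure (unif01 \<Otimes>\<^sub>M \<nu>) start = emeasure \<nu> above_range"
    using U.emeasure_space_1 sets.top[of unif01]
      emeasure_pair_measure_Times[of "space unif01" unif01 above_range]
    by simp
  also have "\<dots> = emeasure (affine_step \<theta> shift \<nu>) above_range"
    by (simp only: fixed)
  also have "\<dots> = emeasure (unif01 \<Otimes>\<^sub>M \<nu>) finish"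
    unfolding affine_step_def F_def[symmetric]
    by (subst emeasure_distr[OF F above_range_measurable])
       (auto simp: finish_def intro!: arg_cong2[where f = emeasure])
  finally have "emeasure (unif01 \<Otimes>\<^sub>M \<nu>) (start - finish) = 0"
    using sets sub by (subst emeasure_Diff) auto
  then have "AE x in unif01 \<Otimes>\<^sub>M \<nu>. x \<notin> start - finish"
    using sets by (intro AE_not_in) (auto simp: null_sets_def)
  then have "AE x in unif01 \<Otimes>\<^sub>M \<nu>. snd x \<in> above_range \<longrightarrow> F (fst x, snd x) \<in> above_range"
    using AE_space[of "unif01 \<Otimes>\<^sub>M \<nu>"]
    by eventually_elim (auto simp: start_def finish_def)
  then have "AE t in \<nu>. AE u in unif01. t \<in> above_range \<longrightarrow> F (u, t) \<in> above_range"
    by (subst (asm) P.AE_pair_iff[symmetric], measurable)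
       (subst P.AE_commute[symmetric], measurable)
  then show ?thesis
  proof eventually_elim
    case (elim t)
    show ?case
    proof
      assume t: "t \<in> above_range"
      \<comment> \<open>For \<open>u \<le> \<delta>\<close> the product \<open>u powr (1 / \<theta>) * shift t\<close> is at most \<open>1 = s 1\<close>.\<close>
      define \<delta> where "\<delta> = (1 / (shift t + 1)) powr \<theta>"
      have g: "0 \<le> shift t" by (rule step.g_nonneg)
      have \<delta>: "0 < \<delta>" "\<delta> \<le> 1"
        using g theta_pos by (auto simp: \<delta>_def intro!: powr_le1)
      have "AE u in unif01. \<delta> < u"
        using elim AE_space[of unif01]
      proof eventually_elim
        case (elim u)
        show ?case
        proof (rule ccontr)
          assume "\<not> \<delta> < u"
          then have "u powr (1 / \<theta>) \<le> \<delta> powr (1 / \<theta>)"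
            using elim theta_pos by (intro powr_mono2) auto
          also have "\<dots> = 1 / (shift t + 1)"
            using g theta_pos by (simp add: \<delta>_def powr_powr)
          finally have "u powr (1 / \<theta>) * shift t \<le> 1 / (shift t + 1) * shift t"
            using g by (rule mult_right_mono)
          also have "\<dots> \<le> s 1"
            using g by (simp add: s_1 field_simps)
          finally have "F (u, t) \<le> s 1"
            by (simp add: F_def)
          moreover have "s 1 < F (u, t)"
            using elim t above_range_iff[of "F (u, t)"] by auto
          ultimately show False by simp
        qed
      qed
      then show False using not_AE_unif01_greater[OF \<delta>] by blast
    qed
  qed
qed

text \<open>
  The fixed law on the utility scale is carried by the range of \<open>s\<close>, hence pulls back; its finite
  mean is the finite mean of \<open>s\<close>.
\<close>

lemma utility_law_exists: "\<exists>\<mu>. nonneg_law \<mu> \<and> integrable \<mu> s \<and> utility_step \<mu> = \<mu>"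
proof -
  obtain \<nu> where \<nu>: "real_distribution \<nu>" and fixed: "affine_step \<theta> shift \<nu> = \<nu>"
    using step.fixed_law_exists by blast
  define \<mu> where "\<mu> = distr \<nu> halfline s_inv"
  have \<mu>: "nonneg_law \<mu>"
    unfolding \<mu>_def by (rule nonneg_law_s_inv[OF \<nu>])
  have "AE t in \<nu>. 0 \<le> t"
    using step.affine_step_nonneg[OF \<nu>] by (simp only: fixed)
  then have s: "distr \<mu> borel s = \<nu>"
    unfolding \<mu>_def by (intro distr_s_s_inv \<nu> fixed_law_in_range fixed)
  have "utility_step \<mu> = \<mu>"
    using utility_step_fixed_iff[OF \<mu>] by (simp only: s fixed)
  moreover have "integrable \<mu> s"
  proof -
    have "integrable (distr \<mu> borel s) (\<lambda>t. t)"
      using step.fixed_law_finite_mean[OF \<nu> fixed] by (simp only: s)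
    then show ?thesis
      by (subst (asm) integrable_distr_eq[OF s_measurable_law[OF \<mu>]]) auto
  qed
  ultimately show ?thesis using \<mu> by blast
qed

section \<open>Comparison with the generalized Dickman distribution\<close>

lemma gen_inverse_eq:
  assumes "0 \<le> x"
  shows "gen_inverse s x = (if x \<in> above_range then \<infinity> else ereal (s_inv x))"
proof (cases "x \<in> above_range")
  case True
  then have "{y. 0 \<le> y \<and> x \<le> s y} = {}"
    by (auto simp: above_range_iff not_le)
  then show ?thesis
    using True by (simp only: gen_inverse_def image_empty Inf_empty top_ereal_def if_True)
next
  case False
  then obtain y where y: "x = s y" "0 \<le> y"
    using in_range_s[OF assms] by auto
  have "{z. 0 \<le> z \<and> x \<le> s z} = {y..}"
    using y by (auto simp: s_le_iff)
  moreover have "Inf (ereal ` {y..}) = ereal y"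
    by (rule antisym) (auto intro: Inf_lower Inf_greatest)
  ultimately show ?thesis
    using False y by (simp add: gen_inverse_def s_inv_s)
qed

lemma gen_inverse_measurable: "gen_inverse s \<in> borel_measurable halfline"
proof -
  note [measurable] = s_inv_measurable
  have "(\<lambda>x. if x \<in> above_range then \<infinity> else ereal (s_inv x)) \<in> borel_measurable borel"
    by measurable
  then have "(\<lambda>x. if x \<in> above_range then \<infinity> else ereal (s_inv x)) \<in> borel_measurable halfline"
    unfolding halfline_def by (rule measurable_restrict_space1)
  then show ?thesis
    by (subst measurable_cong[OF gen_inverse_eq]) auto
qed

lemma le_gen_inverse_iff:
  assumes "0 \<le> a" "0 \<le> x"
  shows "ereal a \<le> gen_inverse s x \<longleftrightarrow> s a \<le> x"
proof (cases "x \<in> above_range")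
  case True
  then have "s a < x" using assms by (simp add: above_range_iff)
  then show ?thesis using True assms by (simp add: gen_inverse_eq)
next
  case False
  then obtain y where "x = s y" "0 \<le> y"
    using in_range_s[OF assms(2)] by auto
  then show ?thesis using assms False by (simp add: gen_inverse_eq s_inv_s s_le_iff)
qed

text \<open>
  On the half-line the shift of the identity is \<open>t + 1\<close>, the largest value that the growth bound
  allows.
\<close>

lemma shift_le_identity_shift:
  "shift t \<le> dickman_utility.shift (\<lambda>x. x) t" if "dickman_utility \<theta> (\<lambda>x. x)"
proof -
  interpret I: dickman_utility \<theta> "\<lambda>x. x" by fact
  have "shift t \<le> max 0 t + 1" by (rule step.g_growth)
  also have "\<dots> \<le> I.shift t" by (rule I.shift_geI) auto
  finally show ?thesis .
qed

end

lemma dickman_utility_identity: "0 < \<theta> \<Longrightarrow> dickman_utility \<theta> (\<lambda>x. x)"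
  by unfold_locales (auto simp: strict_mono_on_def)

lemma is_gen_dickman_iff:
  assumes "0 < \<theta>"
  shows "is_gen_dickman \<theta> \<mu> \<longleftrightarrow> nonneg_law \<mu> \<and> dickman_utility.utility_step \<theta> (\<lambda>x. x) \<mu> = \<mu>"
proof -
  interpret I: dickman_utility \<theta> "\<lambda>x. x" by (rule dickman_utility_identity[OF assms])
  have "distr (unif01 \<Otimes>\<^sub>M \<mu>) halfline (\<lambda>(u, w). u powr (1 / \<theta>) * (w + 1)) = I.utility_step \<mu>"
    if "nonneg_law \<mu>"
    unfolding I.utility_step_def
    by (intro distr_cong) (auto simp: space_pair_measure I.nonneg_lawD[OF that] I.inv_into_s)
  then show ?thesis by (auto simp: is_gen_dickman_def)
qed

text \<open>
  The defining description of \<open>gen_dickman\<close> imposes no moment condition, so uniqueness among all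
  laws is used here.
\<close>

lemma is_gen_dickman_gen_dickman:
  assumes "0 < \<theta>"
  shows "is_gen_dickman \<theta> (gen_dickman \<theta>)"
proof -
  interpret I: dickman_utility \<theta> "\<lambda>x. x" by (rule dickman_utility_identity[OF assms])
  have "\<exists>!\<mu>. is_gen_dickman \<theta> \<mu>"
    using I.utility_law_exists I.utility_law_unique
    unfolding is_gen_dickman_iff[OF assms] by blast
  then show ?thesis
    unfolding gen_dickman_def by (rule theI')
qed

text \<open>
  For real \<open>a \<ge> 0\<close> the events \<open>a \<le> D\<close> and \<open>a \<le> gen_inverse s W\<close> are \<open>s a \<le> s D\<close> and \<open>s a \<le> W\<close>, so
  the claim is the comparison of the two fixed laws at level \<open>s a\<close>. The remaining levels are
  trivial: a nonpositive one is always reached by \<open>W\<close>, and \<open>\<infinity>\<close> is never reached by \<open>D\<close>.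
\<close>

lemma (in dickman_utility) utility_law_st_le:
  assumes "nonneg_law \<mu>" and fixed: "utility_step \<mu> = \<mu>"
  shows "st_le \<mu> ereal (gen_dickman \<theta>) (gen_inverse s)"
proof -
  note id = dickman_utility_identity[OF theta_pos]
  interpret I: dickman_utility \<theta> "\<lambda>x. x" by (rule id)
  define \<rho> where "\<rho> = gen_dickman \<theta>"
  have \<rho>: "nonneg_law \<rho>" "I.utility_step \<rho> = \<rho>"
    using is_gen_dickman_gen_dickman[OF theta_pos]
    unfolding is_gen_dickman_iff[OF theta_pos] \<rho>_def by auto
  interpret M: prob_space \<mu> by (rule nonneg_lawD[OF assms(1)])
  interpret R: prob_space \<rho> by (rule nonneg_lawD[OF \<rho>(1)])
  have ineq: "measure \<mu> {d \<in> space \<mu>. ereal a \<le> ereal d}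
      \<le> measure \<rho> {w \<in> space \<rho>. ereal a \<le> gen_inverse s w}" if a: "0 \<le> a" for a
  proof -
    have "measure \<mu> {d \<in> space \<mu>. ereal a \<le> ereal d} = measure (distr \<mu> borel s) {s a..}"
      by (subst measure_distr[OF s_measurable_law[OF assms(1)]])
         (auto simp: nonneg_lawD[OF assms(1)] s_le_iff a intro!: arg_cong2[where f = measure])
    also have "\<dots> \<le> measure (distr \<rho> borel (\<lambda>x. x)) {s a..}"
    proof (rule fixed_law_mono[OF contractive_shift I.contractive_shift])
      show "shift t \<le> I.shift t" for t by (rule shift_le_identity_shift[OF id])
      show "affine_step \<theta> shift (distr \<mu> borel s) = distr \<mu> borel s"
        using utility_step_fixed_iff[OF assms(1)] fixed by blast
      show "affine_step \<theta> I.shift (distr \<rho> borel (\<lambda>x. x)) = distr \<rho> borel (\<lambda>x. x)"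
        using I.utility_step_fixed_iff[OF \<rho>(1)] \<rho>(2) by blast
    qed (intro real_distribution_s I.real_distribution_s assms(1) \<rho>(1))+
    also have "\<dots> = measure \<rho> {w \<in> space \<rho>. ereal a \<le> gen_inverse s w}"
      by (subst measure_distr[OF I.s_measurable_law[OF \<rho>(1)]])
         (auto simp: nonneg_lawD[OF \<rho>(1)] le_gen_inverse_iff a intro!: arg_cong2[where f = measure])
    finally show ?thesis .
  qed
  have "measure \<mu> {d \<in> space \<mu>. t \<le> ereal d} \<le> measure \<rho> {w \<in> space \<rho>. t \<le> gen_inverse s w}" for t
  proof (cases "t \<le> 0")
    case True
    have "0 \<le> gen_inverse s w" if "0 \<le> w" for w
      using that by (simp add: gen_inverse_eq s_inv_nonneg)
    then have "{w \<in> space \<rho>. t \<le> gen_inverse s w} = space \<rho>"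
      using True by (auto simp: nonneg_lawD[OF \<rho>(1)] intro: order_trans)
    then show ?thesis by (simp add: R.prob_space)
  next
    case False
    then show ?thesis
    proof (cases t)
      case (real a)
      then show ?thesis using False ineq[of a] by simp
    qed auto
  qed
  moreover have "ereal \<in> borel_measurable \<mu>"
  proof -
    have "ereal \<in> borel_measurable halfline"
      unfolding halfline_def by (intro measurable_restrict_space1) simp
    then show ?thesis by (simp add: measurable_cong_sets[OF nonneg_lawD(2)[OF assms(1)] refl])
  qed
  moreover have "gen_inverse s \<in> borel_measurable \<rho>"
    using gen_inverse_measurable
    by (simp add: measurable_cong_sets[OF nonneg_lawD(2)[OF \<rho>(1)] refl])
  ultimately show ?thesis
    unfolding st_le_def \<rho>_def by blast
qed

theorem theorem3p3:
  fixes \<theta> :: real and s :: "real \<Rightarrow> real"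
  assumes "\<theta> > 0"
    and "s ` {0..} \<subseteq> {0..}"
    and "continuous_on {0..} s"
    and "strict_mono_on {0..} s"
    and "s 0 = 0"
    and "s 1 = 1"
    and "\<And>x. x \<ge> 0 \<Longrightarrow> s (x + 1) \<le> s x + 1"
    and "\<And>x y. x \<ge> 0 \<Longrightarrow> y \<ge> 0 \<Longrightarrow> \<bar>s (x + 1) - s (y + 1)\<bar> \<le> \<bar>s x - s y\<bar>"
  shows "(\<exists>!\<mu>. is_dickman_utility_law \<theta> s \<mu>) \<and>
    (\<forall>\<mu>. is_dickman_utility_law \<theta> s \<mu> \<longrightarrow> st_le \<mu> ereal (gen_dickman \<theta>) (gen_inverse s))"
proof -
  interpret dickman_utility \<theta> s
    using assms by unfold_locales
  have iff: "is_dickman_utility_law \<theta> s \<mu> \<longleftrightarrow> nonneg_law \<mu> \<and> integrable \<mu> s \<and> utility_step \<mu> = \<mu>" for \<mu>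
    unfolding is_dickman_utility_law_def utility_step_def by metis
  show ?thesis
    unfolding iff using utility_law_exists utility_law_unique utility_law_st_le by blast
qed

end
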